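(* Let $\mathcal{C}$ be a clone on a nonempty set $A$, let $0<n<\omega$, and let $f\colon A^n\to A$ be an $n$-ary operation on $A$. For every natural number $\lambda<\omega$ the following two conditions are equivalent: $(\dagger)_\lambda$: $f$ is $\lambda$-ultrainterpolable by $\mathcal{C}$; $(\ddagger)_\lambda$: $A^n$ has a finite cover $\mathcal{C}_\lambda\subseteq\mathcal{P}(A^n)$ (i.e. a finite set of subsets of $A^n$ whose union is $A^n$) such that whenever $\mathcal{B}\subseteq\mathcal{C}_\lambda$ satisfies $|\mathcal{B}|\le\lambda$, there exists an $n$-ary operation $t^{[\mathcal{B}]}\in\mathcal{C}$ with $f|_{\bigcup\mathcal{B}}=t^{[\mathcal{B}]}|_{\bigcup\mathcal{B}}$.
   Context: A clone on a nonempty set $A$ is a set of finitary operations on $A$ that contains all projections and is closed under composition (superposition). For an ultrafilter $\mathcal{U}$ on a nonempty set $I$, $A^I/\mathcal{U}$ denotes the ultrapower (classes of $A^I$ modulo agreement on a set in $\mathcal{U}$). For an $n$-ary operation $f$ on $A$, $f_{\mathcal{U}}$ is the $n$-ary operation on $A^I/\mathcal{U}$ given by $f_{\mathcal{U}}(\bar a_1/\mathcal{U},\dots,\bar a_n/\mathcal{U})=f(\bar a_1,\dots,\bar a_n)/\mathcal{U}$ with $f$ applied coordinatewise; $\mathcal{C}_{\mathcal{U}}=\{t_{\mathcal{U}}:t\in\mathcal{C}\}$. For a cardinal $\lambda$, an $n$-ary operation $g$ on a set $X$ is $\lambda$-interpolable by a clone $\mathcal{D}$ on $X$ if for every $S\subseteq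 X^n$ with $|S|\le\lambda$ there is an $n$-ary $t\in\mathcal{D}$ with $g|_S=t|_S$. An operation $f$ on $A$ is $\lambda$-ultrainterpolable by $\mathcal{C}$ if for every ultrafilter $\mathcal{U}$ on every nonempty set $I$, $f_{\mathcal{U}}$ is $\lambda$-interpolable by $\mathcal{C}_{\mathcal{U}}$. *)

theory Defs
  imports Complex_Main "HOL-Library.FuncSet" "HOL-Library.NList"
begin

text \<open>The power \<open>X\<^sup>n\<close> is \<^term>\<open>nlists n X\<close>.  Operations are extensional functions on it.\<close>

definition operations :: "nat \<Rightarrow> 'a set \<Rightarrow> ('a list \<Rightarrow> 'a) set" where
  "operations n X = (nlists n X \<rightarrow>\<^sub>E X)"

definition projection :: "'a set \<Rightarrow> nat \<Rightarrow> nat \<Rightarrow> 'a list \<Rightarrow> 'a" where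
  "projection X n k = (\<lambda>xs\<in>nlists n X. xs ! k)"

definition superposition ::
    "'a set \<Rightarrow> nat \<Rightarrow> ('a list \<Rightarrow> 'a) \<Rightarrow> ('a list \<Rightarrow> 'a) list \<Rightarrow> 'a list \<Rightarrow> 'a" where
  "superposition X n f gs = (\<lambda>xs\<in>nlists n X. f (map (\<lambda>g. g xs) gs))"

text \<open>A set of finitary operations is given as the family of its \<open>n\<close>-ary parts \<open>C n\<close>, because an
  extensional function alone does not determine its arity: the constant operations with value
  \<^term>\<open>undefined\<close> of all arities are the same function.  Clones without nullary
  operations are those with \<open>C 0 = {}\<close>.\<close>

definition clone_on :: "'a set \<Rightarrow> (nat \<Rightarrow> ('a list \<Rightarrow> 'a) set) \<Rightarrow> bool" where
  "clone_on X C \<longleftrightarrow>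
     (\<forall>n. C n \<subseteq> operations n X) \<and>
     (\<forall>n k. k < n \<longrightarrow> projection X n k \<in> C n) \<and>
     (\<forall>m n. \<forall>f\<in>C m. \<forall>gs\<in>nlists m (C n). superposition X n f gs \<in> C n)"

definition ultrafilter_on :: "'i set \<Rightarrow> 'i set set \<Rightarrow> bool" where
  "ultrafilter_on I U \<longleftrightarrow>
     U \<subseteq> Pow I \<and> I \<in> U \<and> {} \<notin> U \<and>
     (\<forall>X\<in>U. \<forall>Y\<in>U. X \<inter> Y \<in> U) \<and>
     (\<forall>X\<in>U. \<forall>Y. X \<subseteq> Y \<and> Y \<subseteq> I \<longrightarrow> Y \<in> U) \<and>
     (\<forall>X. X \<subseteq> I \<longrightarrow> X \<in> U \<or> I - X \<in> U)"

definition ultrapower_rel :: "'i set \<Rightarrow> 'i set set \<Rightarrow> 'a set \<Rightarrow> ('i \<Rightarrow> 'a) rel" where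
  "ultrapower_rel I U A =
     {(a, b). a \<in> (I \<rightarrow>\<^sub>E A) \<and> b \<in> (I \<rightarrow>\<^sub>E A) \<and> {i \<in> I. a i = b i} \<in> U}"

definition ultrapower :: "'i set \<Rightarrow> 'i set set \<Rightarrow> 'a set \<Rightarrow> ('i \<Rightarrow> 'a) set set" where
  "ultrapower I U A = (I \<rightarrow>\<^sub>E A) // ultrapower_rel I U A"

definition coordinatewise :: "'i set \<Rightarrow> ('a list \<Rightarrow> 'a) \<Rightarrow> ('i \<Rightarrow> 'a) list \<Rightarrow> 'i \<Rightarrow> 'a" where
  "coordinatewise I f as = (\<lambda>i\<in>I. f (map (\<lambda>a. a i) as))"

text \<open>The union runs over all tuples of representatives; each of them contributes the same class,
  see \<open>ultrapower_op_class\<close> below.\<close>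

definition ultrapower_op ::
    "'i set \<Rightarrow> 'i set set \<Rightarrow> 'a set \<Rightarrow> nat \<Rightarrow> ('a list \<Rightarrow> 'a) \<Rightarrow>
     ('i \<Rightarrow> 'a) set list \<Rightarrow> ('i \<Rightarrow> 'a) set" where
  "ultrapower_op I U A n f =
     (\<lambda>cs\<in>nlists n (ultrapower I U A).
        \<Union>as\<in>listset cs. ultrapower_rel I U A `` {coordinatewise I f as})"

definition ultrapower_clone ::
    "'i set \<Rightarrow> 'i set set \<Rightarrow> 'a set \<Rightarrow> (nat \<Rightarrow> ('a list \<Rightarrow> 'a) set) \<Rightarrow>
     nat \<Rightarrow> (('i \<Rightarrow> 'a) set list \<Rightarrow> ('i \<Rightarrow> 'a) set) set" where
  "ultrapower_clone I U A C n = ultrapower_op I U A n ` C n"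

definition interpolable ::
    "nat \<Rightarrow> 'x set \<Rightarrow> (nat \<Rightarrow> ('x list \<Rightarrow> 'x) set) \<Rightarrow> nat \<Rightarrow> ('x list \<Rightarrow> 'x) \<Rightarrow> bool" where
  "interpolable l X D n g \<longleftrightarrow>
     (\<forall>S. S \<subseteq> nlists n X \<and> finite S \<and> card S \<le> l \<longrightarrow> (\<exists>t\<in>D n. \<forall>x\<in>S. g x = t x))"

text \<open>HOL cannot quantify over all sets \<open>I\<close> inside a formula, so the type in which the index sets
  live is a parameter.  The property for all \<open>I\<close> is the conjunction of all type instances.  Hence
  "ultrainterpolable iff \<open>P\<close>" is expressed by two implications: \<open>P\<close> implies the instance at an
  arbitrary type \<open>'i\<close>, and one particular instance implies \<open>P\<close>.\<close>

definition ultrainterpolable ::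
    "'i itself \<Rightarrow> nat \<Rightarrow> 'a set \<Rightarrow> (nat \<Rightarrow> ('a list \<Rightarrow> 'a) set) \<Rightarrow> nat \<Rightarrow> ('a list \<Rightarrow> 'a) \<Rightarrow> bool" where
  "ultrainterpolable (_ :: 'i itself) l A C n f \<longleftrightarrow>
     (\<forall>(I :: 'i set) U. I \<noteq> {} \<and> ultrafilter_on I U \<longrightarrow>
        interpolable l (ultrapower I U A) (ultrapower_clone I U A C) n (ultrapower_op I U A n f))"

definition finite_cover_interpolable ::
    "nat \<Rightarrow> 'a set \<Rightarrow> (nat \<Rightarrow> ('a list \<Rightarrow> 'a) set) \<Rightarrow> nat \<Rightarrow> ('a list \<Rightarrow> 'a) \<Rightarrow> bool" where
  "finite_cover_interpolable l A C n f \<longleftrightarrow>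
     (\<exists>K. finite K \<and> K \<subseteq> Pow (nlists n A) \<and> \<Union>K = nlists n A \<and>
        (\<forall>B. B \<subseteq> K \<and> card B \<le> l \<longrightarrow> (\<exists>t\<in>C n. \<forall>x\<in>\<Union>B. f x = t x)))"


lemma equiv_ultrapower_rel:
  assumes "ultrafilter_on I U"
  shows "equiv (I \<rightarrow>\<^sub>E A) (ultrapower_rel I U A)"
proof (rule equivI)
  show "refl_on (I \<rightarrow>\<^sub>E A) (ultrapower_rel I U A)"
    using assms by (auto simp: refl_on_def ultrapower_rel_def ultrafilter_on_def)
  show "sym (ultrapower_rel I U A)"
  proof (rule symI)
    fix a b assume ab: "(a, b) \<in> ultrapower_rel I U A"
    have "{i \<in> I. b i = a i} = {i \<in> I. a i = b i}" by auto
    then show "(b, a) \<in> ultrapower_rel I U A"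
      using ab by (simp add: ultrapower_rel_def)
  qed
  show "trans (ultrapower_rel I U A)"
  proof (rule transI)
    fix a b c assume ab: "(a, b) \<in> ultrapower_rel I U A" and bc: "(b, c) \<in> ultrapower_rel I U A"
    have "{i \<in> I. a i = b i} \<inter> {i \<in> I. b i = c i} \<in> U"
      using ab bc assms by (auto simp: ultrapower_rel_def ultrafilter_on_def)
    moreover have "{i \<in> I. a i = b i} \<inter> {i \<in> I. b i = c i} \<subseteq> {i \<in> I. a i = c i}" by auto
    moreover have "{i \<in> I. a i = c i} \<subseteq> I" by auto
    ultimately have "{i \<in> I. a i = c i} \<in> U"
      using assms unfolding ultrafilter_on_def by blast
    then show "(a, c) \<in> ultrapower_rel I U A"
      using ab bc by (auto simp: ultrapower_rel_def)
  qed
  show "ultrapower_rel I U A \<subseteq> (I \<rightarrow>\<^sub>E A) \<times> (I \<rightarrow>\<^sub>E A)"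
    by (auto simp: ultrapower_rel_def)
qed

lemma listset_classes:
  "bs \<in> listset (map (\<lambda>a. R `` {a}) as) \<longleftrightarrow> list_all2 (\<lambda>a b. (a, b) \<in> R) as bs"
proof (induction as arbitrary: bs)
  case (Cons a as)
  then show ?case by (cases bs) (auto simp: set_Cons_def)
qed simp

lemma ultrapower_rel_agree:
  assumes U: "ultrafilter_on I U"
    and "list_all2 (\<lambda>a b. (a, b) \<in> ultrapower_rel I U A) as bs"
  shows "{i \<in> I. map (\<lambda>a. a i) as = map (\<lambda>b. b i) bs} \<in> U"
  using assms(2)
proof (induction rule: list_all2_induct)
  case Nil
  then show ?case using U by (simp add: ultrafilter_on_def)
next
  case (Cons a as b bs)
  have "{i \<in> I. a i = b i} \<inter> {i \<in> I. map (\<lambda>a. a i) as = map (\<lambda>b. b i) bs} \<in> U"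
    using Cons U by (auto simp: ultrafilter_on_def ultrapower_rel_def)
  moreover have "{i \<in> I. a i = b i} \<inter> {i \<in> I. map (\<lambda>a. a i) as = map (\<lambda>b. b i) bs} =
      {i \<in> I. map (\<lambda>a. a i) (a # as) = map (\<lambda>b. b i) (b # bs)}" by auto
  ultimately show ?case by simp
qed

lemma coordinatewise_closed:
  assumes "f \<in> operations n A" "as \<in> nlists n (I \<rightarrow>\<^sub>E A)"
  shows "coordinatewise I f as \<in> (I \<rightarrow>\<^sub>E A)"
proof -
  have "map (\<lambda>a. a i) as \<in> nlists n A" if "i \<in> I" for i
  proof (rule nlistsI)
    show "length (map (\<lambda>a. a i) as) = n" using assms(2) by simp
    show "set (map (\<lambda>a. a i) as) \<subseteq> A"
      using nlistsE_set[OF assms(2)] that by (force dest: PiE_mem)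
  qed
  then show ?thesis
    using assms(1) by (auto simp: coordinatewise_def operations_def)
qed

lemma ultrapower_op_class:
  assumes U: "ultrafilter_on I U" and f: "f \<in> operations n A" and as: "as \<in> nlists n (I \<rightarrow>\<^sub>E A)"
  shows "ultrapower_op I U A n f (map (\<lambda>a. ultrapower_rel I U A `` {a}) as) =
         ultrapower_rel I U A `` {coordinatewise I f as}"
proof -
  let ?R = "ultrapower_rel I U A"
  have eqv: "equiv (I \<rightarrow>\<^sub>E A) ?R" by (rule equiv_ultrapower_rel[OF U])
  have mem: "map (\<lambda>a. ?R `` {a}) as \<in> nlists n (ultrapower I U A)"
  proof (rule nlistsI)
    show "length (map (\<lambda>a. ?R `` {a}) as) = n" using as by simp
    show "set (map (\<lambda>a. ?R `` {a}) as) \<subseteq> ultrapower I U A"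
    proof
      fix c assume "c \<in> set (map (\<lambda>a. ?R `` {a}) as)"
      then obtain a where a: "a \<in> set as" and c: "c = ?R `` {a}" by (simp only: set_map) blast
      have "a \<in> (I \<rightarrow>\<^sub>E A)" by (rule subsetD[OF nlistsE_set[OF as] a])
      then show "c \<in> ultrapower I U A" unfolding c ultrapower_def by (rule quotientI)
    qed
  qed
  have same: "?R `` {coordinatewise I f bs} = ?R `` {coordinatewise I f as}"
    if "bs \<in> listset (map (\<lambda>a. ?R `` {a}) as)" for bs
  proof -
    have rel: "list_all2 (\<lambda>a b. (a, b) \<in> ?R) as bs"
      using that by (simp add: listset_classes)
    have "bs \<in> nlists n (I \<rightarrow>\<^sub>E A)"
    proof (rule nlistsI)
      show "length bs = n" using as list_all2_lengthD[OF rel] by simp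
      show "set bs \<subseteq> (I \<rightarrow>\<^sub>E A)"
        using rel by (induction rule: list_all2_induct) (simp_all add: ultrapower_rel_def)
    qed
    then have cl: "coordinatewise I f bs \<in> (I \<rightarrow>\<^sub>E A)" "coordinatewise I f as \<in> (I \<rightarrow>\<^sub>E A)"
      using coordinatewise_closed[OF f] as by blast+
    have "{i \<in> I. map (\<lambda>a. a i) as = map (\<lambda>b. b i) bs} \<in> U"
      by (rule ultrapower_rel_agree[OF U rel])
    moreover have "{i \<in> I. map (\<lambda>a. a i) as = map (\<lambda>b. b i) bs} \<subseteq>
        {i \<in> I. coordinatewise I f as i = coordinatewise I f bs i}"
      unfolding coordinatewise_def by (auto simp del: map_eq_conv)
    moreover have "{i \<in> I. coordinatewise I f as i = coordinatewise I f bs i} \<subseteq> I" by auto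
    ultimately have "{i \<in> I. coordinatewise I f as i = coordinatewise I f bs i} \<in> U"
      using U unfolding ultrafilter_on_def by blast
    then have "(coordinatewise I f as, coordinatewise I f bs) \<in> ?R"
      using cl by (simp add: ultrapower_rel_def)
    then show ?thesis by (rule equiv_class_eq[OF eqv, symmetric])
  qed
  have "list_all2 (\<lambda>a b. (a, b) \<in> ?R) as as"
    using nlistsE_set[OF as] equiv_class_self[OF eqv] by (simp add: list_all2_same subset_iff)
  then have "as \<in> listset (map (\<lambda>a. ?R `` {a}) as)" by (simp add: listset_classes)
  then have "(\<Union>bs\<in>listset (map (\<lambda>a. ?R `` {a}) as). ?R `` {coordinatewise I f bs}) =
      ?R `` {coordinatewise I f as}"
    using same by blast
  then show ?thesis using mem by (simp add: ultrapower_op_def)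
qed

end

theory Submission
  imports Defs
begin

text \<open>For an operation \<open>t\<close> let \<open>E t\<close> be the set of points at which \<open>f\<close> and \<open>t\<close> agree.  Apply
  ultrainterpolability to the index set \<open>I = (A\<^sup>n)\<^sup>l\<close> and to its \<open>l\<close> coordinate projections, regarded
  as \<open>l\<close> points of the \<open>n\<close>-th power of the ultrapower: no ultrafilter on \<open>I\<close> avoids all the sets
  \<open>(E t)\<^sup>l\<close>, so finitely many of these cover \<open>I\<close>.  The atoms of the Boolean algebra generated by the
  corresponding \<open>E t\<close> are the required cover, since agreement of \<open>f\<close> and \<open>t\<close> on an atom can be tested
  at a single representative.  Conversely, an ultrafilter selects one member of a finite cover for
  each point of the \<open>n\<close>-th power of the ultrapower.\<close>

section \<open>Ultrafilters on a set: closure properties and the extension of families with the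
  finite intersection property\<close>

lemma ultrafilter_on_Int:
  assumes "ultrafilter_on I U" "X \<in> U" "Y \<in> U"
  shows "X \<inter> Y \<in> U"
  using assms unfolding ultrafilter_on_def by blast

lemma ultrafilter_on_upward:
  assumes "ultrafilter_on I U" "X \<in> U" "X \<subseteq> Y" "Y \<subseteq> I"
  shows "Y \<in> U"
  using assms unfolding ultrafilter_on_def by blast

lemma ultrafilter_on_Compl:
  assumes "ultrafilter_on I U" "X \<subseteq> I" "X \<notin> U"
  shows "I - X \<in> U"
  using assms unfolding ultrafilter_on_def by blast

lemma ultrafilter_on_Ball:
  assumes U: "ultrafilter_on I U" and "finite J" and "\<And>j. j \<in> J \<Longrightarrow> {i \<in> I. P i j} \<in> U"
  shows "{i \<in> I. \<forall>j\<in>J. P i j} \<in> U"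
  using assms(2,3)
proof (induction J rule: finite_induct)
  case empty
  then show ?case using U by (simp add: ultrafilter_on_def)
next
  case (insert j J)
  have "{i \<in> I. P i j} \<inter> {i \<in> I. \<forall>j\<in>J. P i j} \<in> U"
    using insert by (intro ultrafilter_on_Int[OF U]) auto
  moreover have "{i \<in> I. P i j} \<inter> {i \<in> I. \<forall>j\<in>J. P i j} = {i \<in> I. \<forall>j\<in>insert j J. P i j}"
    by auto
  ultimately show ?case by simp
qed

text \<open>If every set of a finite union were missing from \<open>U\<close>, all their complements
  would lie in \<open>U\<close>, and so would the intersection of these, which is disjoint from the
  union. This primeness is what makes an ultrafilter choose a member of a finite cover.\<close>

lemma ultrafilter_on_Bex:
  assumes U: "ultrafilter_on I U" and "finite J" and "{i \<in> I. \<exists>j\<in>J. P i j} \<in> U"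
  obtains j where "j \<in> J" "{i \<in> I. P i j} \<in> U"
proof (rule ccontr)
  assume "\<not> thesis"
  then have none: "\<forall>j\<in>J. {i \<in> I. P i j} \<notin> U" using that by blast
  have "{i \<in> I. \<not> P i j} \<in> U" if "j \<in> J" for j
  proof -
    have "I - {i \<in> I. P i j} = {i \<in> I. \<not> P i j}" by auto
    moreover have "I - {i \<in> I. P i j} \<in> U"
      using none that by (intro ultrafilter_on_Compl[OF U]) auto
    ultimately show ?thesis by simp
  qed
  then have "{i \<in> I. \<forall>j\<in>J. \<not> P i j} \<in> U" by (rule ultrafilter_on_Ball[OF U assms(2)])
  then have "{i \<in> I. \<exists>j\<in>J. P i j} \<inter> {i \<in> I. \<forall>j\<in>J. \<not> P i j} \<in> U"
    using assms(3) by (intro ultrafilter_on_Int[OF U])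
  moreover have "{i \<in> I. \<exists>j\<in>J. P i j} \<inter> {i \<in> I. \<forall>j\<in>J. \<not> P i j} = {}" by auto
  ultimately show False using U by (simp add: ultrafilter_on_def)
qed

text \<open>Zorn's lemma gives a maximal family with the finite intersection property above
  \<open>F\<close>, and maximality makes it an ultrafilter. Intersecting with \<open>I\<close> gives
  the empty \<open>G\<close> its intended meaning, since \<open>\<Inter>{}\<close> is the universe
  of the type; for \<open>G = {}\<close> the condition says that \<open>I\<close> is
  nonempty.\<close>

lemma ultrafilter_on_extending:
  assumes F: "F \<subseteq> Pow I" and fip: "\<And>G. G \<subseteq> F \<Longrightarrow> finite G \<Longrightarrow> I \<inter> \<Inter>G \<noteq> {}"
  obtains U where "ultrafilter_on I U" "F \<subseteq> U"
proof -
  define P where "P = {M. F \<subseteq> M \<and> M \<subseteq> Pow I \<and> (\<forall>G. G \<subseteq> M \<longrightarrow> finite G \<longrightarrow> I \<inter> \<Inter>G \<noteq> {})}"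
  have "\<exists>M\<in>P. \<forall>X\<in>P. M \<subseteq> X \<longrightarrow> X = M"
  proof (rule subset_Zorn_nonempty)
    have "F \<in> P" using F fip by (simp add: P_def)
    then show "P \<noteq> {}" by blast
  next
    fix \<C> assume ne: "\<C> \<noteq> {}" and ch: "subset.chain P \<C>"
    then have CP: "\<C> \<subseteq> P" by (simp add: subset.chain_def)
    have "I \<inter> \<Inter>G \<noteq> {}" if G: "G \<subseteq> \<Union>\<C>" "finite G" for G
    proof -
      obtain M where "M \<in> \<C>" "G \<subseteq> M"
        using finite_subset_Union_chain[OF G(2,1) ne ch] by blast
      then show ?thesis using CP G(2) unfolding P_def by blast
    qed
    moreover have "F \<subseteq> M \<and> M \<subseteq> Pow I" if "M \<in> \<C>" for M using CP that by (auto simp: P_def)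
    then have "F \<subseteq> \<Union>\<C>" "\<Union>\<C> \<subseteq> Pow I" using ne by blast+
    ultimately show "\<Union>\<C> \<in> P" by (simp add: P_def)
  qed
  then obtain M where M: "M \<in> P" and max: "\<And>X. X \<in> P \<Longrightarrow> M \<subseteq> X \<Longrightarrow> X = M" by blast
  have MI: "M \<subseteq> Pow I" and FM: "F \<subseteq> M" using M by (auto simp: P_def)
  have Mfip: "I \<inter> \<Inter>G \<noteq> {}" if "G \<subseteq> M" "finite G" for G
    using M that unfolding P_def by blast
  \<comment> \<open>Maximality as a membership test: adjoining such an \<open>X\<close> to
    \<open>M\<close> keeps the finite intersection property. The closure conditions of an
    ultrafilter are all verified through this test.\<close>
  have mem: "X \<in> M" if X: "X \<subseteq> I" and meets: "\<And>G. G \<subseteq> M \<Longrightarrow> finite G \<Longrightarrow> X \<inter> \<Inter>G \<noteq> {}" for X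
  proof -
    have "I \<inter> \<Inter>G \<noteq> {}" if "G \<subseteq> insert X M" "finite G" for G
    proof -
      have "X \<inter> \<Inter>(G - {X}) \<noteq> {}" using that by (intro meets) auto
      moreover have "X \<inter> \<Inter>(G - {X}) \<subseteq> I \<inter> \<Inter>G" using X by auto
      ultimately show ?thesis by blast
    qed
    then have "insert X M \<in> P" using FM MI X by (simp add: P_def subset_insertI2)
    then show ?thesis using max[of "insert X M"] by auto
  qed
  have "ultrafilter_on I M"
    unfolding ultrafilter_on_def
  proof (intro conjI ballI allI impI)
    show "M \<subseteq> Pow I" by (rule MI)
    show "I \<in> M" using Mfip by (intro mem) auto
    show "{} \<notin> M" using Mfip[of "{{}}"] by auto
  next
    fix X Y assume XY: "X \<in> M" "Y \<in> M"
    show "X \<inter> Y \<in> M"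
    proof (rule mem)
      show "X \<inter> Y \<subseteq> I" using XY MI by auto
      fix G assume "G \<subseteq> M" "finite G"
      then show "X \<inter> Y \<inter> \<Inter>G \<noteq> {}" using Mfip[of "insert X (insert Y G)"] XY by auto
    qed
  next
    fix X Y assume XY: "X \<in> M" "X \<subseteq> Y \<and> Y \<subseteq> I"
    show "Y \<in> M"
    proof (rule mem)
      show "Y \<subseteq> I" using XY by simp
      fix G assume "G \<subseteq> M" "finite G"
      then show "Y \<inter> \<Inter>G \<noteq> {}" using Mfip[of "insert X G"] XY by auto
    qed
  next
    fix X assume XI: "X \<subseteq> I"
    show "X \<in> M \<or> I - X \<in> M"
    proof (rule ccontr)
      assume "\<not> (X \<in> M \<or> I - X \<in> M)"
      \<comment> \<open>When the test fails for both sets, the witnesses \<open>G\<close> and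
        \<open>H\<close> together leave no point of \<open>I\<close>, neither inside nor outside
        \<open>X\<close>.\<close>
      then obtain G H where G: "G \<subseteq> M" "finite G" "X \<inter> \<Inter>G = {}"
        and H: "H \<subseteq> M" "finite H" "(I - X) \<inter> \<Inter>H = {}"
        using mem[of X] mem[of "I - X"] XI by blast
      have "I \<inter> \<Inter>(G \<union> H) \<noteq> {}" using G H by (intro Mfip) auto
      then show False using G(3) H(3) by blast
    qed
  qed
  then show thesis using FM that by blast
qed

section \<open>Tuples over the ultrapower, their representatives, and equality of operations at
  them\<close>

lemma coordinates_in_nlists:
  assumes "as \<in> nlists n (I \<rightarrow>\<^sub>E A)" "i \<in> I"
  shows "map (\<lambda>a. a i) as \<in> nlists n A"
proof (rule nlistsI)
  show "length (map (\<lambda>a. a i) as) = n" using assms(1) by simp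
  show "set (map (\<lambda>a. a i) as) \<subseteq> A"
    using nlistsE_set[OF assms(1)] assms(2) by (force dest: PiE_mem)
qed

lemma map_class_in_nlists:
  assumes "as \<in> nlists n (I \<rightarrow>\<^sub>E A)"
  shows "map (\<lambda>a. ultrapower_rel I U A `` {a}) as \<in> nlists n (ultrapower I U A)"
proof (rule nlistsI)
  show "length (map (\<lambda>a. ultrapower_rel I U A `` {a}) as) = n" using assms by simp
  show "set (map (\<lambda>a. ultrapower_rel I U A `` {a}) as) \<subseteq> ultrapower I U A"
    using nlistsE_set[OF assms] by (force simp: ultrapower_def intro: quotientI)
qed

lemma ultrapower_tuple_representatives:
  assumes "s \<in> nlists n (ultrapower I U A)"
  obtains as where "as \<in> nlists n (I \<rightarrow>\<^sub>E A)" "s = map (\<lambda>a. ultrapower_rel I U A `` {a}) as"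
proof -
  let ?cl = "\<lambda>a. ultrapower_rel I U A `` {a}"
  have "set s \<subseteq> ?cl ` (I \<rightarrow>\<^sub>E A)"
    using nlistsE_set[OF assms] by (auto simp: ultrapower_def quotient_def)
  then have "s \<in> lists (?cl ` (I \<rightarrow>\<^sub>E A))" by auto
  then obtain as where "as \<in> lists (I \<rightarrow>\<^sub>E A)" "s = map ?cl as" by (auto simp: lists_image)
  moreover from this have "as \<in> nlists n (I \<rightarrow>\<^sub>E A)"
    using nlistsE_length[OF assms] by (intro nlistsI) auto
  ultimately show thesis using that by blast
qed

text \<open>The theorem of Los for the single equation between \<open>f\<close> and
  \<open>t\<close>. It turns interpolation in the ultrapower into membership of agreement sets in
  \<open>U\<close>.\<close>

lemma ultrapower_op_eq_iff:
  assumes U: "ultrafilter_on I U" and f: "f \<in> operations n A" and t: "t \<in> operations n A"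
    and as: "as \<in> nlists n (I \<rightarrow>\<^sub>E A)"
  defines "s \<equiv> map (\<lambda>a. ultrapower_rel I U A `` {a}) as"
  shows "ultrapower_op I U A n f s = ultrapower_op I U A n t s \<longleftrightarrow>
         {i \<in> I. f (map (\<lambda>a. a i) as) = t (map (\<lambda>a. a i) as)} \<in> U"
proof -
  let ?R = "ultrapower_rel I U A"
  have "ultrapower_op I U A n f s = ultrapower_op I U A n t s \<longleftrightarrow>
      ?R `` {coordinatewise I f as} = ?R `` {coordinatewise I t as}"
    unfolding s_def by (simp only: ultrapower_op_class[OF U f as] ultrapower_op_class[OF U t as])
  also have "\<dots> \<longleftrightarrow> (coordinatewise I f as, coordinatewise I t as) \<in> ?R"
    by (rule eq_equiv_class_iff[OF equiv_ultrapower_rel[OF U]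
        coordinatewise_closed[OF f as] coordinatewise_closed[OF t as]])
  also have "\<dots> \<longleftrightarrow> {i \<in> I. coordinatewise I f as i = coordinatewise I t as i} \<in> U"
    using coordinatewise_closed[OF f as] coordinatewise_closed[OF t as]
    by (simp add: ultrapower_rel_def)
  also have "{i \<in> I. coordinatewise I f as i = coordinatewise I t as i} =
      {i \<in> I. f (map (\<lambda>a. a i) as) = t (map (\<lambda>a. a i) as)}"
    by (auto simp: coordinatewise_def)
  finally show ?thesis .
qed

section \<open>Finite covers: their effect on ultrapowers, and their construction from finitely many
  operations\<close>

lemma finite_cover_imp_ultrainterpolable:
  assumes C: "\<And>t. t \<in> C n \<Longrightarrow> t \<in> operations n A" and f: "f \<in> operations n A"
    and cover: "finite_cover_interpolable l A C n f"
  shows "ultrainterpolable TYPE('i) l A C n f"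
  unfolding ultrainterpolable_def interpolable_def
proof (intro allI impI, elim conjE)
  fix I :: "'i set" and U S
  assume U: "ultrafilter_on I U" and S: "S \<subseteq> nlists n (ultrapower I U A)"
    and "finite S" "card S \<le> l"
  obtain K where K: "finite K" "\<Union>K = nlists n A"
    and interp: "\<forall>B. B \<subseteq> K \<and> card B \<le> l \<longrightarrow> (\<exists>t\<in>C n. \<forall>x\<in>\<Union>B. f x = t x)"
    using cover unfolding finite_cover_interpolable_def by metis
  let ?cl = "\<lambda>a. ultrapower_rel I U A `` {a}"
  have "\<exists>as k. as \<in> nlists n (I \<rightarrow>\<^sub>E A) \<and> s = map ?cl as \<and> k \<in> K \<and>
      {i \<in> I. map (\<lambda>a. a i) as \<in> k} \<in> U" if "s \<in> S" for s
  proof -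
    obtain as where as: "as \<in> nlists n (I \<rightarrow>\<^sub>E A)" "s = map ?cl as"
      using ultrapower_tuple_representatives S \<open>s \<in> S\<close> by blast
    \<comment> \<open>At every index the representative takes its value in some member of
      \<open>K\<close>, so by primeness a single member catches its values on a set in
      \<open>U\<close>.\<close>
    have "{i \<in> I. \<exists>k\<in>K. map (\<lambda>a. a i) as \<in> k} = I"
      using coordinates_in_nlists[OF as(1)] K(2) by blast
    then have "{i \<in> I. \<exists>k\<in>K. map (\<lambda>a. a i) as \<in> k} \<in> U"
      using U by (simp add: ultrafilter_on_def)
    then obtain k where "k \<in> K" "{i \<in> I. map (\<lambda>a. a i) as \<in> k} \<in> U"
      by (rule ultrafilter_on_Bex[OF U K(1)])
    then show ?thesis using as by blast
  qed
  then have "\<forall>s\<in>S. \<exists>as k. as \<in> nlists n (I \<rightarrow>\<^sub>E A) \<and> s = map ?cl as \<and> k \<in> K \<and>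
      {i \<in> I. map (\<lambda>a. a i) as \<in> k} \<in> U" by blast
  then obtain as k where rep: "\<forall>s\<in>S. as s \<in> nlists n (I \<rightarrow>\<^sub>E A) \<and> s = map ?cl (as s) \<and>
      k s \<in> K \<and> {i \<in> I. map (\<lambda>a. a i) (as s) \<in> k s} \<in> U"
    unfolding bchoice_iff by blast
  have as: "as s \<in> nlists n (I \<rightarrow>\<^sub>E A)" and s: "s = map ?cl (as s)" and k: "k s \<in> K"
    and in_k: "{i \<in> I. map (\<lambda>a. a i) (as s) \<in> k s} \<in> U" if "s \<in> S" for s
    using rep that by blast+
  \<comment> \<open>Distinct points of \<open>S\<close> may select the same member of
    \<open>K\<close>; only the bound by \<open>l\<close> matters, and it allows one \<open>t\<close>
    to serve all points of \<open>S\<close> at once.\<close>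
  have "card (k ` S) \<le> l" using card_image_le[OF \<open>finite S\<close>, of k] \<open>card S \<le> l\<close> by simp
  moreover have "k ` S \<subseteq> K" using k by blast
  ultimately obtain t where t: "t \<in> C n" and "\<forall>x\<in>\<Union>(k ` S). f x = t x"
    using interp by metis
  then have eq: "f x = t x" if "s \<in> S" "x \<in> k s" for s x using that by blast
  have "ultrapower_op I U A n f s = ultrapower_op I U A n t s" if "s \<in> S" for s
  proof -
    have "{i \<in> I. f (map (\<lambda>a. a i) (as s)) = t (map (\<lambda>a. a i) (as s))} \<in> U"
      by (rule ultrafilter_on_upward[OF U in_k[OF that]]) (use eq[OF that] in auto)
    then have "ultrapower_op I U A n f (map ?cl (as s)) = ultrapower_op I U A n t (map ?cl (as s))"
      using ultrapower_op_eq_iff[OF U f C[OF t] as[OF that]] by blast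
    then show ?thesis using s[OF that] by simp
  qed
  then show "\<exists>t\<in>ultrapower_clone I U A C n. \<forall>s\<in>S. ultrapower_op I U A n f s = t s"
    using t unfolding ultrapower_clone_def by blast
qed

text \<open>Call two points equivalent when the same operations of \<open>T\<close> agree with
  \<open>f\<close> there. Finiteness of \<open>T\<close> leaves finitely many classes, and an
  operation of \<open>T\<close> that agrees with \<open>f\<close> at one point of a class does so on
  the whole class. Hence interpolation at one representative per class extends to the union of at
  most \<open>l\<close> classes.\<close>

lemma finite_cover_interpolableI:
  assumes T: "finite T" "T \<subseteq> C n"
    and interp: "\<And>S. S \<subseteq> nlists n A \<Longrightarrow> finite S \<Longrightarrow> card S \<le> l \<Longrightarrow> \<exists>t\<in>T. \<forall>x\<in>S. f x = t x"
  shows "finite_cover_interpolable l A C n f"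
proof -
  define type where "type x = {t \<in> T. f x = t x}" for x
  define atom where "atom p = {y \<in> nlists n A. type y = p}" for p
  \<comment> \<open>Only types that occur are used, so every atom has a point to represent
    it.\<close>
  define K where "K = (\<lambda>x. atom (type x)) ` nlists n A"
  have "K \<subseteq> atom ` Pow T" by (auto simp: K_def type_def)
  then have fin: "finite K" using T(1) finite_subset by blast
  have "\<exists>t\<in>C n. \<forall>x\<in>\<Union>B. f x = t x" if B: "B \<subseteq> K" "card B \<le> l" for B
  proof -
    have "\<forall>b\<in>B. \<exists>x. x \<in> nlists n A \<and> b = atom (type x)" using B(1) by (auto simp: K_def)
    then obtain r where r: "\<And>b. b \<in> B \<Longrightarrow> r b \<in> nlists n A"
      and atom: "\<And>b. b \<in> B \<Longrightarrow> b = atom (type (r b))"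
      by metis
    have "finite B" using B(1) fin by (rule finite_subset)
    then have "card (r ` B) \<le> l" using card_image_le[of B r] B(2) by simp
    then obtain t where t: "t \<in> T" and eq: "\<And>b. b \<in> B \<Longrightarrow> f (r b) = t (r b)"
      using interp[of "r ` B"] r \<open>finite B\<close> by blast
    have "f x = t x" if "b \<in> B" "x \<in> b" for b x
    proof -
      have "type x = type (r b)" using atom[OF that(1)] that(2) by (auto simp: atom_def)
      then show ?thesis using t eq[OF that(1)] by (auto simp: type_def)
    qed
    then show ?thesis using t T(2) by blast
  qed
  moreover have "K \<subseteq> Pow (nlists n A)" "\<Union>K = nlists n A" by (auto simp: K_def atom_def)
  ultimately show ?thesis using fin unfolding finite_cover_interpolable_def by blast
qed

section \<open>Flattened tuples of points, and the passage from ultrapowers to a finite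
  cover\<close>

definition block :: "nat \<Rightarrow> nat \<Rightarrow> 'a list \<Rightarrow> 'a list" where
  "block n j xs = map (\<lambda>k. xs ! (j * n + k)) [0..<n]"

lemma block_index_less:
  fixes j k l n :: nat
  assumes "j < l" "k < n"
  shows "j * n + k < l * n"
proof -
  have "j * n + k < Suc j * n" using assms(2) by simp
  also have "\<dots> \<le> l * n" using assms(1) by (intro mult_le_mono1) simp
  finally show ?thesis .
qed

text \<open>Every set of at most \<open>l\<close> points is read off from one element of the index
  set used below, so a finite cover of that index set controls all such sets.\<close>

lemma blocks_cover:
  assumes "A \<noteq> {}" "S \<subseteq> nlists n A" "finite S" "card S \<le> l"
  obtains xs where "xs \<in> nlists (l * n) A" "S \<subseteq> (\<lambda>j. block n j xs) ` {..<l}"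
proof -
  obtain a where a: "a \<in> A" using assms(1) by blast
  obtain ss where ss: "set ss = S" "length ss = card S"
    using finite_distinct_list[OF assms(3)] distinct_card by metis
  \<comment> \<open>If \<open>S\<close> has fewer than \<open>l\<close> points, the list is padded
    with a constant tuple; the entry \<open>a\<close> exists because \<open>A\<close> is
    nonempty.\<close>
  define ys where "ys = ss @ replicate (l - card S) (replicate n a)"
  have len: "length ys = l" using ss assms(4) by (simp add: ys_def)
  have ys: "ys ! j \<in> nlists n A" if "j < l" for j
  proof -
    have "replicate n a \<in> nlists n A" using a by (intro nlistsI) auto
    then have "set ys \<subseteq> nlists n A" using ss(1) assms(2) by (auto simp: ys_def)
    then show ?thesis using that len by (metis nth_mem subsetD)
  qed
  \<comment> \<open>Concatenation: position \<open>m\<close> falls in block \<open>m div n\<close>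
    at offset \<open>m mod n\<close>. For \<open>n = 0\<close> there are no positions.\<close>
  define xs where "xs = map (\<lambda>m. ys ! (m div n) ! (m mod n)) [0..<l * n]"
  have "xs \<in> nlists (l * n) A"
  proof (rule nlistsI)
    show "set xs \<subseteq> A"
    proof
      fix x assume "x \<in> set xs"
      then obtain m where m: "m < l * n" "x = ys ! (m div n) ! (m mod n)" by (auto simp: xs_def)
      then have "0 < n" by (cases n) auto
      then have "m div n < l" "m mod n < n" using m(1) by (auto simp: less_mult_imp_div_less)
      then show "x \<in> A" using ys m(2) by (metis nlistsE_length nlistsE_set nth_mem subsetD)
    qed
  qed (simp add: xs_def)
  moreover have "block n j xs = ys ! j" if "j < l" for j
  proof (rule nth_equalityI)
    show "length (block n j xs) = length (ys ! j)" using ys[OF that] by (simp add: block_def)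
    fix k assume "k < length (block n j xs)"
    then have k: "k < n" by (simp add: block_def)
    then show "block n j xs ! k = ys ! j ! k"
      using block_index_less[OF that k] by (simp add: block_def xs_def)
  qed
  moreover have "S \<subseteq> (!) ys ` {..<l}"
    using ss(1) len by (force simp: ys_def in_set_conv_nth nth_append)
  ultimately show thesis by (intro that[of xs]) auto
qed

lemma ultrainterpolable_imp_finite_cover:
  fixes A :: "'a set"
  assumes A: "A \<noteq> {}" and C: "\<And>t. t \<in> C n \<Longrightarrow> t \<in> operations n A" and f: "f \<in> operations n A"
    and ultra: "ultrainterpolable TYPE('a list) l A C n f"
  shows "finite_cover_interpolable l A C n f"
proof -
  \<comment> \<open>The power \<open>(A\<^sup>n)\<^sup>l\<close> is flattened to lists of length
    \<open>l * n\<close>, so indices have type \<open>'a list\<close> whatever \<open>n\<close> and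
    \<open>l\<close> are. Accordingly \<open>E t\<close> is the \<open>l\<close>-th power of the set
    on which \<open>f\<close> and \<open>t\<close> agree.\<close>
  define I where "I = nlists (l * n) A"
  define E where "E t = {xs \<in> I. \<forall>j\<in>{..<l}. f (block n j xs) = t (block n j xs)}" for t
  have "\<exists>T. finite T \<and> T \<subseteq> C n \<and> I \<subseteq> \<Union>(E ` T)"
  proof (rule ccontr)
    assume no_cover: "\<not> ?thesis"
    \<comment> \<open>If no finitely many sets \<open>E t\<close> cover \<open>I\<close>, their
      complements have the finite intersection property and lie in a common ultrafilter.\<close>
    have "I \<inter> \<Inter>G \<noteq> {}" if G: "G \<subseteq> (\<lambda>t. I - E t) ` C n" "finite G" for G
    proof -
      obtain T where T: "finite T" "T \<subseteq> C n" "G = (\<lambda>t. I - E t) ` T"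
        using finite_subset_image[OF G(2,1)] by blast
      then have "\<not> I \<subseteq> \<Union>(E ` T)" using no_cover by blast
      then show ?thesis unfolding T(3) by blast
    qed
    moreover have "(\<lambda>t. I - E t) ` C n \<subseteq> Pow I" by blast
    ultimately obtain U where U: "ultrafilter_on I U" and avoid: "(\<lambda>t. I - E t) ` C n \<subseteq> U"
      using ultrafilter_on_extending by metis
    have "I \<noteq> {}" using U unfolding ultrafilter_on_def by blast
    let ?cl = "\<lambda>a. ultrapower_rel I U A `` {a}"
    \<comment> \<open>The \<open>j\<close>-th generic point: its \<open>k\<close>-th entry is the
      coordinate function of position \<open>j * n + k\<close>, so at index \<open>xs\<close> the
      tuple \<open>as j\<close> evaluates to \<open>block n j xs\<close>.\<close>
    define as where "as j = map (\<lambda>k. \<lambda>xs\<in>I. xs ! (j * n + k)) [0..<n]" for j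
    have as: "as j \<in> nlists n (I \<rightarrow>\<^sub>E A)" if "j < l" for j
    proof (rule nlistsI)
      have "xs ! (j * n + k) \<in> A" if "xs \<in> I" "k < n" for xs k
        using that block_index_less[OF \<open>j < l\<close> \<open>k < n\<close>] unfolding I_def
        by (metis nlistsE_length nlistsE_set nth_mem subsetD)
      then show "set (as j) \<subseteq> (I \<rightarrow>\<^sub>E A)" by (auto simp: as_def)
    qed (simp add: as_def)
    have coords: "map (\<lambda>a. a xs) (as j) = block n j xs" if "xs \<in> I" for xs j
      using that by (simp add: as_def block_def)
    define S where "S = (\<lambda>j. map ?cl (as j)) ` {..<l}"
    have "S \<subseteq> nlists n (ultrapower I U A)"
      using map_class_in_nlists[OF as] by (auto simp: S_def simp del: in_nlists_UNIV)
    moreover have "finite S" "card S \<le> l"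
      using card_image_le[of "{..<l}" "\<lambda>j. map ?cl (as j)"] by (auto simp: S_def)
    moreover have "interpolable l (ultrapower I U A) (ultrapower_clone I U A C) n
        (ultrapower_op I U A n f)"
      using ultra U \<open>I \<noteq> {}\<close> unfolding ultrainterpolable_def by blast
    ultimately have "\<exists>u\<in>ultrapower_clone I U A C n. \<forall>s\<in>S. ultrapower_op I U A n f s = u s"
      unfolding interpolable_def by blast
    then obtain t where t: "t \<in> C n"
      and eq: "\<forall>s\<in>S. ultrapower_op I U A n f s = ultrapower_op I U A n t s"
      unfolding ultrapower_clone_def by blast
    have "{xs \<in> I. f (block n j xs) = t (block n j xs)} \<in> U" if "j \<in> {..<l}" for j
    proof -
      have "j < l" using that by simp
      have "ultrapower_op I U A n f (map ?cl (as j)) = ultrapower_op I U A n t (map ?cl (as j))"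
        using that eq unfolding S_def by blast
      then have "{xs \<in> I. f (map (\<lambda>a. a xs) (as j)) = t (map (\<lambda>a. a xs) (as j))} \<in> U"
        using ultrapower_op_eq_iff[OF U f C[OF t] as[OF \<open>j < l\<close>]] by blast
      moreover have "{xs \<in> I. f (map (\<lambda>a. a xs) (as j)) = t (map (\<lambda>a. a xs) (as j))} =
          {xs \<in> I. f (block n j xs) = t (block n j xs)}"
        using coords by auto
      ultimately show ?thesis by simp
    qed
    \<comment> \<open>Agreement at all \<open>l\<close> generic points puts the finite intersection
      \<open>E t\<close> into \<open>U\<close>, while \<open>U\<close> was chosen to contain its
      complement.\<close>
    then have "E t \<in> U" unfolding E_def by (intro ultrafilter_on_Ball[OF U]) auto
    moreover have "I - E t \<in> U" using avoid t by blast
    ultimately have "E t \<inter> (I - E t) \<in> U" by (rule ultrafilter_on_Int[OF U])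
    then show False using U by (simp add: ultrafilter_on_def)
  qed
  then obtain T where T: "finite T" "T \<subseteq> C n" "I \<subseteq> \<Union>(E ` T)" by blast
  show ?thesis
  proof (rule finite_cover_interpolableI[where C = C, OF T(1,2)])
    fix S assume "S \<subseteq> nlists n A" "finite S" "card S \<le> l"
    then obtain xs where xs: "xs \<in> I" "S \<subseteq> (\<lambda>j. block n j xs) ` {..<l}"
      using blocks_cover[OF A] unfolding I_def by blast
    then obtain t where "t \<in> T" "xs \<in> E t" using T(3) by blast
    then show "\<exists>t\<in>T. \<forall>x\<in>S. f x = t x" using xs(2) unfolding E_def by blast
  qed
qed

text \<open>The index type \<open>'a list\<close> suffices to produce the cover because it carries
  the flattened power; the cover then serves every index type \<open>'i\<close>.\<close>

theorem theorem3p1: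
  fixes A :: "'a set" and C :: "nat \<Rightarrow> ('a list \<Rightarrow> 'a) set"
    and n :: nat and f :: "'a list \<Rightarrow> 'a" and l :: nat
  assumes "A \<noteq> {}" and "clone_on A C" and "0 < n" and "f \<in> operations n A"
  shows "(ultrainterpolable TYPE('a list) l A C n f \<longleftrightarrow> finite_cover_interpolable l A C n f) \<and>
         (finite_cover_interpolable l A C n f \<longrightarrow> ultrainterpolable TYPE('i) l A C n f)"
proof -
  have C: "t \<in> operations n A" if "t \<in> C n" for t
    using assms(2) that unfolding clone_on_def by blast
  show ?thesis
  proof (intro conjI iffI impI)
    show "finite_cover_interpolable l A C n f" if "ultrainterpolable TYPE('a list) l A C n f"
      by (rule ultrainterpolable_imp_finite_cover[where C = C and n = n,
          OF assms(1) _ assms(4) that]) (rule C)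
    show "ultrainterpolable TYPE('a list) l A C n f" if "finite_cover_interpolable l A C n f"
      by (rule finite_cover_imp_ultrainterpolable[where C = C and n = n,
          OF _ assms(4) that]) (rule C)
    show "ultrainterpolable TYPE('i) l A C n f" if "finite_cover_interpolable l A C n f"
      by (rule finite_cover_imp_ultrainterpolable[where C = C and n = n,
          OF _ assms(4) that]) (rule C)
  qed
qed

end
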